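(* Every infinite structure $\mathcal{M}$ has an amenable expansion $\mathcal{M}'$ with $|\mathcal{L}(\mathcal{M}')|=\max\{|\mathcal{L}(\mathcal{M})|,\aleph_0\}$. Indeed, given any nonprincipal ultrafilter $\mathcal{U}\subseteq\mathcal{P}(M)$, there is an expansion $\mathcal{M}'$ of $\mathcal{M}$ with definable Skolem functions such that $|\mathcal{L}(\mathcal{M}')|=\max\{|\mathcal{L}(\mathcal{M})|,\aleph_0\}$, and some $\mathcal{U}'\subseteq\mathcal{U}$ such that $\mathcal{U}'$ is an $\mathcal{M}'$-amenable ultrafilter.
   Context: A set $X\subseteq M^k$ is parametrically $\mathcal{M}$-definable if it is defined in $\mathcal{M}$ by a formula with parameters from $M$. $\mathcal{M}$ has definable Skolem functions if for every $\mathcal{L}(\mathcal{M})$-formula $\varphi(x,y_1,\dots,y_k)$ there is an $\mathcal{M}$-definable function $f$ with $\mathcal{M}\models\forall\bar y(\exists x\,\varphi(x,\bar y)\to\varphi(f(\bar y),\bar y))$. Let $\mathcal{U}$ be a nonprincipal ultrafilter on the Boolean algebra of parametrically $\mathcal{M}$-definable subsets of $M$. $\mathcal{U}$ is $\mathcal{M}$-amenable if for every $\mathcal{L}(\mathcal{M})$-formula $\varphi(x,y_1,\dots,y_k)$ there is an $\mathcal{L}(\mathcal{M})$-formula $U_\varphi(y_1,\dots,y_k)$ such that for all $m_1,\dots,m_k\in M$: $\{a\in M:\mathcal{M}\models\varphi(a,m_1,\dots,m_k)\}\in\mathcal{U}$ iff $\mathcal{M}\models U_\varphi(m_1,\dots,m_k)$.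 $\mathcal{M}$ is amenable if $\mathcal{M}$ has definable Skolem functions and there exists an $\mathcal{M}$-amenable ultrafilter. *)

theory Defs
  imports Main "HOL-Library.Equipollence"
begin

text \<open>
  First-order logic with equality. A language is a partial map assigning to each of its
  (non-logical) symbols a kind and an arity; constants are function symbols of arity 0.
\<close>

datatype kind = FunSym nat | RelSym nat

type_synonym 's language = "'s \<rightharpoonup> kind"

datatype 's tm = Var nat | App 's "'s tm list"

datatype 's fm =
    Equal "'s tm" "'s tm"
  | Atom 's "'s tm list"
  | Neg "'s fm"
  | Conj "'s fm" "'s fm"
  | Exists nat "'s fm"

fun tm_in :: "'s language \<Rightarrow> 's tm \<Rightarrow> bool" where
  "tm_in L (Var i) \<longleftrightarrow> True"
| "tm_in L (App s ts) \<longleftrightarrow> L s = Some (FunSym (length ts)) \<and> (\<forall>t\<in>set ts. tm_in L t)"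

fun fm_in :: "'s language \<Rightarrow> 's fm \<Rightarrow> bool" where
  "fm_in L (Equal t u) \<longleftrightarrow> tm_in L t \<and> tm_in L u"
| "fm_in L (Atom s ts) \<longleftrightarrow> L s = Some (RelSym (length ts)) \<and> (\<forall>t\<in>set ts. tm_in L t)"
| "fm_in L (Neg p) \<longleftrightarrow> fm_in L p"
| "fm_in L (Conj p q) \<longleftrightarrow> fm_in L p \<and> fm_in L q"
| "fm_in L (Exists i p) \<longleftrightarrow> fm_in L p"

fun tm_vars :: "'s tm \<Rightarrow> nat set" where
  "tm_vars (Var i) = {i}"
| "tm_vars (App s ts) = (\<Union>t\<in>set ts. tm_vars t)"

fun free_vars :: "'s fm \<Rightarrow> nat set" where
  "free_vars (Equal t u) = tm_vars t \<union> tm_vars u"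
| "free_vars (Atom s ts) = (\<Union>t\<in>set ts. tm_vars t)"
| "free_vars (Neg p) = free_vars p"
| "free_vars (Conj p q) = free_vars p \<union> free_vars q"
| "free_vars (Exists i p) = free_vars p - {i}"

text \<open>
  Formulas in $n$ free variables, these being the variables $0, \ldots, n-1$. A formula
  $\varphi(x, y_1, \ldots, y_k)$ is a member of \<open>formulas L (Suc k)\<close>, with $x$ the variable $0$
  and $y_i$ the variable $i$.
\<close>

definition formulas :: "'s language \<Rightarrow> nat \<Rightarrow> 's fm set" where
  "formulas L n = {p. fm_in L p \<and> free_vars p \<subseteq> {..<n}}"

record ('s, 'm) fo_structure =
  univ :: "'m set"
  lang :: "'s language"
  fun_interp :: "'s \<Rightarrow> 'm list \<Rightarrow> 'm"
  rel_interp :: "'s \<Rightarrow> 'm list \<Rightarrow> bool"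

definition tuples :: "('s, 'm) fo_structure \<Rightarrow> nat \<Rightarrow> 'm list set" where
  "tuples M n = {xs. length xs = n \<and> set xs \<subseteq> univ M}"

definition is_structure :: "('s, 'm) fo_structure \<Rightarrow> bool" where
  "is_structure M \<longleftrightarrow> univ M \<noteq> {} \<and>
     (\<forall>s n. lang M s = Some (FunSym n) \<longrightarrow> (\<forall>xs\<in>tuples M n. fun_interp M s xs \<in> univ M))"

fun tm_val :: "('s, 'm) fo_structure \<Rightarrow> (nat \<Rightarrow> 'm) \<Rightarrow> 's tm \<Rightarrow> 'm" where
  "tm_val M e (Var i) = e i"
| "tm_val M e (App s ts) = fun_interp M s (map (tm_val M e) ts)"

fun sat :: "('s, 'm) fo_structure \<Rightarrow> (nat \<Rightarrow> 'm) \<Rightarrow> 's fm \<Rightarrow> bool" where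
  "sat M e (Equal t u) \<longleftrightarrow> tm_val M e t = tm_val M e u"
| "sat M e (Atom s ts) \<longleftrightarrow> rel_interp M s (map (tm_val M e) ts)"
| "sat M e (Neg p) \<longleftrightarrow> \<not> sat M e p"
| "sat M e (Conj p q) \<longleftrightarrow> sat M e p \<and> sat M e q"
| "sat M e (Exists i p) \<longleftrightarrow> (\<exists>a\<in>univ M. sat M (e(i := a)) p)"

text \<open>
  Only used with \<open>p \<in> formulas L (length xs)\<close>, so that the unspecified values of
  \<open>xs ! i\<close> for \<open>i \<ge> length xs\<close> are irrelevant.
\<close>

definition holds :: "('s, 'm) fo_structure \<Rightarrow> 's fm \<Rightarrow> 'm list \<Rightarrow> bool" where
  "holds M p xs \<longleftrightarrow> sat M (\<lambda>i. xs ! i) p"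

definition param_definable :: "('s, 'm) fo_structure \<Rightarrow> nat \<Rightarrow> 'm list set \<Rightarrow> bool" where
  "param_definable M k X \<longleftrightarrow>
     (\<exists>n. \<exists>p\<in>formulas (lang M) (k + n). \<exists>bs\<in>tuples M n. X = {xs \<in> tuples M k. holds M p (xs @ bs)})"

definition definable_algebra :: "('s, 'm) fo_structure \<Rightarrow> 'm set set" where
  "definable_algebra M = {A. A \<subseteq> univ M \<and> param_definable M 1 ((\<lambda>a. [a]) ` A)}"

text \<open>``Definable'' without ``parametrically'' means definable without parameters.\<close>

definition definable_function :: "('s, 'm) fo_structure \<Rightarrow> nat \<Rightarrow> ('m list \<Rightarrow> 'm) \<Rightarrow> bool" where
  "definable_function M k f \<longleftrightarrow>
     (\<forall>ys\<in>tuples M k. f ys \<in> univ M) \<and>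
     (\<exists>q\<in>formulas (lang M) (Suc k).
        \<forall>ys\<in>tuples M k. \<forall>z\<in>univ M. f ys = z \<longleftrightarrow> holds M q (z # ys))"

definition has_definable_Skolem_functions :: "('s, 'm) fo_structure \<Rightarrow> bool" where
  "has_definable_Skolem_functions M \<longleftrightarrow>
     (\<forall>k. \<forall>p\<in>formulas (lang M) (Suc k). \<exists>f. definable_function M k f \<and>
        (\<forall>ys\<in>tuples M k. (\<exists>x\<in>univ M. holds M p (x # ys)) \<longrightarrow> holds M p (f ys # ys)))"

text \<open>Ultrafilters on a Boolean algebra \<open>B\<close> of subsets of \<open>S\<close>.\<close>

definition ultrafilter_on :: "'m set \<Rightarrow> 'm set set \<Rightarrow> 'm set set \<Rightarrow> bool" where
  "ultrafilter_on S B U \<longleftrightarrow>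
     U \<subseteq> B \<and> S \<in> U \<and> {} \<notin> U \<and>
     (\<forall>X\<in>U. \<forall>Y\<in>U. X \<inter> Y \<in> U) \<and>
     (\<forall>X\<in>U. \<forall>Y\<in>B. X \<subseteq> Y \<longrightarrow> Y \<in> U) \<and>
     (\<forall>X\<in>B. X \<in> U \<or> S - X \<in> U)"

definition nonprincipal_ultrafilter_on :: "'m set \<Rightarrow> 'm set set \<Rightarrow> 'm set set \<Rightarrow> bool" where
  "nonprincipal_ultrafilter_on S B U \<longleftrightarrow>
     ultrafilter_on S B U \<and> \<not> (\<exists>A\<in>B. U = {X \<in> B. A \<subseteq> X})"

definition amenable_ultrafilter :: "('s, 'm) fo_structure \<Rightarrow> 'm set set \<Rightarrow> bool" where
  "amenable_ultrafilter M U \<longleftrightarrow>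
     nonprincipal_ultrafilter_on (univ M) (definable_algebra M) U \<and>
     (\<forall>k. \<forall>p\<in>formulas (lang M) (Suc k). \<exists>q\<in>formulas (lang M) k.
        \<forall>ms\<in>tuples M k. {a \<in> univ M. holds M p (a # ms)} \<in> U \<longleftrightarrow> holds M q ms)"

definition amenable :: "('s, 'm) fo_structure \<Rightarrow> bool" where
  "amenable M \<longleftrightarrow> has_definable_Skolem_functions M \<and> (\<exists>U. amenable_ultrafilter M U)"

text \<open>
  Since HOL cannot quantify over types inside a formula, the symbols of an expansion live in a
  type given in advance, into which the old symbols are embedded by an injection \<open>\<iota>\<close>.
\<close>

definition expansion_via ::
    "('s \<Rightarrow> 't) \<Rightarrow> ('s, 'm) fo_structure \<Rightarrow> ('t, 'm) fo_structure \<Rightarrow> bool" where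
  "expansion_via \<iota> M M' \<longleftrightarrow>
     is_structure M' \<and> univ M' = univ M \<and> inj_on \<iota> (dom (lang M)) \<and>
     (\<forall>s\<in>dom (lang M). lang M' (\<iota> s) = lang M s) \<and>
     (\<forall>s n. lang M s = Some (FunSym n) \<longrightarrow>
        (\<forall>xs\<in>tuples M n. fun_interp M' (\<iota> s) xs = fun_interp M s xs)) \<and>
     (\<forall>s n. lang M s = Some (RelSym n) \<longrightarrow>
        (\<forall>xs\<in>tuples M n. rel_interp M' (\<iota> s) xs = rel_interp M s xs))"

text \<open>
  $|L'| = \max\{|L|, \aleph_0\}$, where the cardinality of a language is that of its set of
  symbols. The maximum is spelled out by cases because the sets involved have different types.
\<close>

definition card_is_max_aleph0 :: "'t language \<Rightarrow> 's language \<Rightarrow> bool" where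
  "card_is_max_aleph0 L' L \<longleftrightarrow>
     (dom L \<lesssim> (UNIV :: nat set) \<longrightarrow> dom L' \<approx> (UNIV :: nat set)) \<and>
     ((UNIV :: nat set) \<lesssim> dom L \<longrightarrow> dom L' \<approx> dom L)"

text \<open>
  Symbol type for expansions: the old symbols \<open>Inl s\<close> together with a supply \<open>Inr w\<close> of
  potential new ones. The supply \<open>'s list\<close> always has cardinality $\max\{|{'s}|, \aleph_0\}$.
\<close>

type_synonym 's exp_symbol = "'s + 's list"

end

theory Submission imports Defs begin

text \<open>
  Adding Skolem functions and the predicates $U_\varphi$ creates new formulas, which need symbols
  in turn. All symbols are therefore generated at once: the new symbols form an inductive
  datatype in which every formula \<open>p\<close> over the symbols yields a function symbol \<open>Skolem k p\<close>,
  interpreted by a choice of witnesses for \<open>p\<close>, and a relation symbol \<open>Large k p\<close>, true of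
  exactly those parameters for which \<open>p\<close> defines a set in \<open>U\<close>. The resulting language is closed
  under both operations, and the trace of \<open>U\<close> on its definable sets is amenable. A prefix code
  by finite words over $L \sqcup \mathbb{N}$ bounds the number of symbols by
  $\max\{|L|, \aleph_0\}$.
\<close>

subsection \<open>Ultrafilters\<close>

lemma ultrafilter_onI:
  assumes "U \<subseteq> B" "S \<in> U" "{} \<notin> U" "\<And>X Y. X \<in> U \<Longrightarrow> Y \<in> U \<Longrightarrow> X \<inter> Y \<in> U"
    "\<And>X Y. X \<in> U \<Longrightarrow> Y \<in> B \<Longrightarrow> X \<subseteq> Y \<Longrightarrow> Y \<in> U"
    "\<And>X. X \<in> B \<Longrightarrow> X \<in> U \<or> S - X \<in> U"
  shows "ultrafilter_on S B U"
  using assms unfolding ultrafilter_on_def by blast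

lemma ultrafilter_onD:
  assumes "ultrafilter_on S B U"
  shows "U \<subseteq> B" "S \<in> U" "{} \<notin> U" "X \<in> U \<Longrightarrow> Y \<in> U \<Longrightarrow> X \<inter> Y \<in> U"
    "X \<in> U \<Longrightarrow> Y \<in> B \<Longrightarrow> X \<subseteq> Y \<Longrightarrow> Y \<in> U" "X \<in> B \<Longrightarrow> X \<in> U \<or> S - X \<in> U"
  using assms unfolding ultrafilter_on_def by simp_all

text \<open>If \<open>{a}\<close> were a member, every member would have to meet it and hence
  contain \<open>a\<close>; upward closure then makes \<open>U\<close> the principal ultrafilter
  generated by \<open>{a}\<close>.\<close>

lemma singleton_notin_nonprincipal_ultrafilter:
  assumes "nonprincipal_ultrafilter_on S (Pow S) U"
  shows "{a} \<notin> U"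
proof
  assume a: "{a} \<in> U"
  have U: "ultrafilter_on S (Pow S) U"
    and np: "\<And>A. A \<in> Pow S \<Longrightarrow> U \<noteq> {X \<in> Pow S. A \<subseteq> X}"
    using assms unfolding nonprincipal_ultrafilter_on_def by auto
  have "a \<in> X" if "X \<in> U" for X
  proof (rule ccontr)
    assume "a \<notin> X"
    then have "{a} \<inter> X = {}" by blast
    then show False using U a that unfolding ultrafilter_on_def by metis
  qed
  then have "U = {X \<in> Pow S. {a} \<subseteq> X}"
    using U a unfolding ultrafilter_on_def by blast
  moreover have "{a} \<in> Pow S" using U a unfolding ultrafilter_on_def by blast
  ultimately show False using np by blast
qed

text \<open>Zorn's lemma applied to the proper filters extending the cofinite filter, which is
  itself proper because \<open>S\<close> is infinite. Maximality gives the ultrafilter property, and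
  the cofinite sets rule out a generator.\<close>

lemma nonprincipal_ultrafilter_exists:
  assumes "infinite S"
  shows "\<exists>U. nonprincipal_ultrafilter_on S (Pow S) U"
proof -
  define cof where "cof = {X. X \<subseteq> S \<and> finite (S - X)}"
  define \<F> where "\<F> = {F. cof \<subseteq> F \<and> F \<subseteq> Pow S \<and> {} \<notin> F \<and>
      (\<forall>X\<in>F. \<forall>Y\<in>F. X \<inter> Y \<in> F) \<and> (\<forall>X\<in>F. \<forall>Y\<in>Pow S. X \<subseteq> Y \<longrightarrow> Y \<in> F)}"
  have "cof \<in> \<F>"
    unfolding \<F>_def
  proof (intro CollectI conjI ballI impI)
    show "{} \<notin> cof" using assms by (simp add: cof_def)
    show "X \<inter> Y \<in> cof" if "X \<in> cof" "Y \<in> cof" for X Y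
      using that by (auto simp: cof_def Diff_Int)
    show "Y \<in> cof" if "X \<in> cof" "Y \<in> Pow S" "X \<subseteq> Y" for X Y
    proof -
      have "S - Y \<subseteq> S - X" using that by blast
      then show ?thesis using that by (auto simp: cof_def intro: finite_subset)
    qed
  qed (auto simp: cof_def)
  then have "\<F> \<noteq> {}" by blast
  then have "\<exists>U\<in>\<F>. \<forall>X\<in>\<F>. U \<subseteq> X \<longrightarrow> X = U"
  proof (rule subset_Zorn_nonempty)
    fix \<C> assume ne: "\<C> \<noteq> {}" and ch: "subset.chain \<F> \<C>"
    have sub: "\<C> \<subseteq> \<F>" and total: "\<And>F G. F \<in> \<C> \<Longrightarrow> G \<in> \<C> \<Longrightarrow> F \<subseteq> G \<or> G \<subseteq> F"
      using ch unfolding subset.chain_def by auto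
    show "\<Union>\<C> \<in> \<F>"
      unfolding \<F>_def
    proof (intro CollectI conjI ballI impI)
      obtain F where F: "F \<in> \<C>" using ne by blast
      then have "cof \<subseteq> F" using sub unfolding \<F>_def by blast
      then show "cof \<subseteq> \<Union>\<C>" using F by blast
      show "\<Union>\<C> \<subseteq> Pow S" using sub unfolding \<F>_def by blast
      show "{} \<notin> \<Union>\<C>" using sub unfolding \<F>_def by blast
      show "Y \<in> \<Union>\<C>" if "X \<in> \<Union>\<C>" "Y \<in> Pow S" "X \<subseteq> Y" for X Y
        using that sub unfolding \<F>_def by blast
      show "X \<inter> Y \<in> \<Union>\<C>" if XY: "X \<in> \<Union>\<C>" "Y \<in> \<Union>\<C>" for X Y
      proof -
        obtain F G where "F \<in> \<C>" "G \<in> \<C>" "X \<in> F" "Y \<in> G" using XY by blast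
        with total[of F G] obtain H where "H \<in> \<C>" "X \<in> H" "Y \<in> H" by blast
        then show ?thesis using sub unfolding \<F>_def by blast
      qed
    qed
  qed
  then obtain U where U: "U \<in> \<F>" and max: "\<And>X. X \<in> \<F> \<Longrightarrow> U \<subseteq> X \<Longrightarrow> X = U" by blast
  have Usub: "U \<subseteq> Pow S" and Uempty: "{} \<notin> U" and Ucof: "cof \<subseteq> U"
    and Uint: "\<And>X Y. X \<in> U \<Longrightarrow> Y \<in> U \<Longrightarrow> X \<inter> Y \<in> U"
    and Uup: "\<And>X Y. X \<in> U \<Longrightarrow> Y \<subseteq> S \<Longrightarrow> X \<subseteq> Y \<Longrightarrow> Y \<in> U"
    using U unfolding \<F>_def by auto
  have S: "S \<in> U" using Ucof by (auto simp: cof_def)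
  have "X \<in> U \<or> S - X \<in> U" if X: "X \<subseteq> S" for X
  proof (cases "\<exists>Z\<in>U. Z \<inter> X = {}")
    case True
    then show ?thesis using Uup[of _ "S - X"] Usub by blast
  next
    case False
    \<comment> \<open>\<open>F\<close> is the filter generated by \<open>U\<close> and
      \<open>X\<close>. It is proper because no member of \<open>U\<close> misses \<open>X\<close>,
      so maximality gives \<open>F = U\<close> and hence \<open>X \<in> U\<close>.\<close>
    define F where "F = {Y. Y \<subseteq> S \<and> (\<exists>Z\<in>U. Z \<inter> X \<subseteq> Y)}"
    have UF: "U \<subseteq> F" using Usub by (auto simp: F_def)
    have "F \<in> \<F>"
      unfolding \<F>_def
    proof (intro CollectI conjI ballI impI)
      show "cof \<subseteq> F" using Ucof UF by blast
      show "{} \<notin> F" using False by (auto simp: F_def)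
      show "Y \<inter> Y' \<in> F" if Y: "Y \<in> F" "Y' \<in> F" for Y Y'
      proof -
        obtain Z Z' where Z: "Z \<in> U" "Z' \<in> U" "Z \<inter> X \<subseteq> Y" "Z' \<inter> X \<subseteq> Y'"
          using Y by (auto simp: F_def)
        then have "(Z \<inter> Z') \<inter> X \<subseteq> Y \<inter> Y'" by blast
        then show ?thesis using Uint[OF Z(1,2)] Y unfolding F_def by blast
      qed
    qed (unfold F_def, blast+)
    then have "F = U" using max UF by blast
    moreover have "X \<in> F" using X S by (auto simp: F_def)
    ultimately show ?thesis by blast
  qed
  then have ultra: "ultrafilter_on S (Pow S) U"
    using Usub S Uempty Uint Uup by (intro ultrafilter_onI) auto
  have "U \<noteq> {X \<in> Pow S. A \<subseteq> X}" if A: "A \<subseteq> S" for A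
  proof
    assume eq: "U = {X \<in> Pow S. A \<subseteq> X}"
    with A have "A \<in> U" by blast
    with Uempty have "A \<noteq> {}" by auto
    \<comment> \<open>A generator lies below every member of \<open>U\<close>, but the cofinite set
      \<open>S - {a}\<close> is a member that omits the point \<open>a\<close> of
      \<open>A\<close>.\<close>
    then obtain a where a: "a \<in> A" by blast
    have "S - (S - {a}) = {a}" using a A by blast
    then have "S - {a} \<in> cof" by (simp add: cof_def)
    then have "A \<subseteq> S - {a}" using Ucof eq by blast
    then show False using a by blast
  qed
  then show ?thesis using ultra unfolding nonprincipal_ultrafilter_on_def by blast
qed

subsection \<open>Renaming and definable sets\<close>

text \<open>Bound variables are to be renamed along with free ones, so that an injective
  \<open>r\<close> causes no capture and no fresh variables have to be chosen.\<close>

fun rename_tm :: "(nat \<Rightarrow> nat) \<Rightarrow> 's tm \<Rightarrow> 's tm" where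
  "rename_tm r (Var i) = Var (r i)"
| "rename_tm r (App s ts) = App s (map (rename_tm r) ts)"

fun rename_fm :: "(nat \<Rightarrow> nat) \<Rightarrow> 's fm \<Rightarrow> 's fm" where
  "rename_fm r (Equal t u) = Equal (rename_tm r t) (rename_tm r u)"
| "rename_fm r (Atom s ts) = Atom s (map (rename_tm r) ts)"
| "rename_fm r (Neg p) = Neg (rename_fm r p)"
| "rename_fm r (Conj p q) = Conj (rename_fm r p) (rename_fm r q)"
| "rename_fm r (Exists i p) = Exists (r i) (rename_fm r p)"

lemma tm_in_rename_tm [simp]: "tm_in L (rename_tm r t) = tm_in L t"
  by (induction t) auto

lemma fm_in_rename_fm [simp]: "fm_in L (rename_fm r p) = fm_in L p"
  by (induction p) auto

lemma tm_vars_rename_tm [simp]: "tm_vars (rename_tm r t) = r ` tm_vars t"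
  by (induction t) auto

lemma free_vars_rename_fm:
  assumes "inj r"
  shows "free_vars (rename_fm r p) = r ` free_vars p"
  by (induction p) (auto simp: image_set_diff[OF assms])

lemma tm_val_rename_tm [simp]: "tm_val M e (rename_tm r t) = tm_val M (\<lambda>i. e (r i)) t"
proof (induction t)
  case (App s ts)
  then have "map (tm_val M e \<circ> rename_tm r) ts = map (tm_val M (\<lambda>i. e (r i))) ts" by simp
  then show ?case by (simp only: rename_tm.simps tm_val.simps map_map)
qed simp

lemma sat_rename_fm:
  assumes "inj r"
  shows "sat M e (rename_fm r p) = sat M (\<lambda>i. e (r i)) p"
proof (induction p arbitrary: e)
  case (Atom s ts)
  have "map (tm_val M e) (map (rename_tm r) ts) = map (tm_val M (\<lambda>i. e (r i))) ts" by simp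
  then show ?case by (simp only: rename_fm.simps sat.simps)
next
  case (Exists i p)
  \<comment> \<open>Injectivity enters here: changing the value at \<open>r i\<close> must affect no
    variable other than \<open>i\<close> after renaming.\<close>
  have "(\<lambda>j. (e(r i := a)) (r j)) = (\<lambda>j. e (r j))(i := a)" for a
    using assms by (auto simp: fun_eq_iff inj_eq)
  then show ?case unfolding rename_fm.simps sat.simps Exists by (simp only:)
qed simp_all

lemma tm_val_cong: "(\<And>i. i \<in> tm_vars t \<Longrightarrow> e i = e' i) \<Longrightarrow> tm_val M e t = tm_val M e' t"
proof (induction t)
  case (App s ts)
  have "tm_val M e t = tm_val M e' t" if "t \<in> set ts" for t
    by (rule App.IH[OF that]) (use App.prems that in auto)
  then have "map (tm_val M e) ts = map (tm_val M e') ts" by simp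
  then show ?case by (simp only: tm_val.simps)
qed simp

lemma sat_cong: "(\<And>i. i \<in> free_vars p \<Longrightarrow> e i = e' i) \<Longrightarrow> sat M e p = sat M e' p"
proof (induction p arbitrary: e e')
  case (Equal t u)
  have "tm_val M e t = tm_val M e' t" "tm_val M e u = tm_val M e' u"
    by (rule tm_val_cong, rule Equal.prems, simp)+
  then show ?case by (simp only: sat.simps)
next
  case (Atom s ts)
  have "tm_val M e t = tm_val M e' t" if "t \<in> set ts" for t
    by (rule tm_val_cong, rule Atom.prems) (use that in auto)
  then have "map (tm_val M e) ts = map (tm_val M e') ts" by simp
  then show ?case by (simp only: sat.simps)
next
  case (Neg p)
  have "sat M e p = sat M e' p"
    by (rule Neg.IH, rule Neg.prems) simp
  then show ?case by (simp only: sat.simps)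
next
  case (Conj p q)
  have "sat M e p = sat M e' p" by (rule Conj.IH(1), rule Conj.prems) simp
  moreover have "sat M e q = sat M e' q" by (rule Conj.IH(2), rule Conj.prems) simp
  ultimately show ?case by (simp only: sat.simps)
next
  case (Exists i p)
  have "(e(i := a)) j = (e'(i := a)) j" if "j \<in> free_vars p" for a j
    using Exists.prems[of j] that by (cases "j = i") simp_all
  then have "sat M (e(i := a)) p = sat M (e'(i := a)) p" for a
    by (rule Exists.IH)
  then show ?case by (simp only: sat.simps)
qed

lemma tm_val_map_tm:
  assumes "\<And>s. fun_interp N s = fun_interp M (h s)"
  shows "tm_val N e t = tm_val M e (map_tm h t)"
proof (induction t)
  case (App s ts)
  then have "map (tm_val N e) ts = map (tm_val M e) (map (map_tm h) ts)" by simp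
  then show ?case by (simp only: tm.map tm_val.simps assms)
qed simp

text \<open>Satisfaction consults only the universe and the interpretations of symbols, never
  \<open>lang\<close>. A formula can therefore be moved along any map \<open>h\<close> of symbols
  through which the interpretations factor.\<close>

lemma sat_map_fm:
  assumes "univ N = univ M" "\<And>s. fun_interp N s = fun_interp M (h s)"
    "\<And>s. rel_interp N s = rel_interp M (h s)"
  shows "sat N e p = sat M e (map_fm h p)"
proof (induction p arbitrary: e)
  case (Atom s ts)
  have "map (tm_val N e) ts = map (tm_val M e) (map (map_tm h) ts)"
    using tm_val_map_tm[OF assms(2)] by simp
  then show ?case by (simp only: fm.map sat.simps assms)
qed (simp_all add: assms(1) tm_val_map_tm[OF assms(2)])

section \<open>The Boolean algebra of parametrically definable sets\<close>

lemma definable_algebra_iff: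
  fixes M :: "('s, 'm) fo_structure"
  shows "A \<in> definable_algebra M \<longleftrightarrow>
     (\<exists>n. \<exists>p\<in>formulas (lang M) (Suc n). \<exists>bs\<in>tuples M n. A = {a \<in> univ M. holds M p (a # bs)})"
proof -
  have "tuples M 1 = (\<lambda>a. [a]) ` univ M"
    by (auto simp: tuples_def length_Suc_conv)
  then have "{xs \<in> tuples M 1. holds M p (xs @ bs)} = (\<lambda>a. [a]) ` {a \<in> univ M. holds M p (a # bs)}"
    for p bs by auto
  \<comment> \<open>Cancelling the embedding of elements as one-element lists leaves formulas with
    the tested element at variable 0 and the parameters after it, the same shape as in the
    definition of amenability.\<close>
  moreover have "inj (\<lambda>a :: 'm. [a])" by (rule injI) simp
  ultimately have "(\<lambda>a. [a]) ` A = {xs \<in> tuples M 1. holds M p (xs @ bs)} \<longleftrightarrow>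
      A = {a \<in> univ M. holds M p (a # bs)}" for p bs
    by (simp only: inj_image_eq_iff)
  then have "A \<in> definable_algebra M \<longleftrightarrow> A \<subseteq> univ M \<and>
     (\<exists>n. \<exists>p\<in>formulas (lang M) (Suc n). \<exists>bs\<in>tuples M n. A = {a \<in> univ M. holds M p (a # bs)})"
    by (simp only: definable_algebra_def param_definable_def mem_Collect_eq plus_1_eq_Suc)
  then show ?thesis by blast
qed

lemma definable_algebraI:
  "p \<in> formulas (lang M) (Suc n) \<Longrightarrow> bs \<in> tuples M n \<Longrightarrow>
     {a \<in> univ M. holds M p (a # bs)} \<in> definable_algebra M"
  unfolding definable_algebra_iff by blast

lemma univ_in_definable_algebra: "univ M \<in> definable_algebra M"
  using definable_algebraI[of "Equal (Var 0) (Var 0)" M 0 "[]"]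
  by (simp add: formulas_def tuples_def holds_def)

lemma singleton_in_definable_algebra:
  assumes "a \<in> univ M"
  shows "{a} \<in> definable_algebra M"
proof -
  have "{b \<in> univ M. holds M (Equal (Var 0) (Var 1)) (b # [a])} = {a}"
    using assms by (auto simp: holds_def)
  then show ?thesis
    using definable_algebraI[of "Equal (Var 0) (Var 1)" M 1 "[a]"] assms
    by (simp add: formulas_def tuples_def)
qed

lemma Diff_in_definable_algebra:
  assumes "A \<in> definable_algebra M"
  shows "univ M - A \<in> definable_algebra M"
proof -
  obtain n p bs where p: "p \<in> formulas (lang M) (Suc n)" "bs \<in> tuples M n"
    and A: "A = {a \<in> univ M. holds M p (a # bs)}"
    using assms unfolding definable_algebra_iff by blast
  have "univ M - A = {a \<in> univ M. holds M (Neg p) (a # bs)}"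
    unfolding A by (auto simp: holds_def)
  then show ?thesis
    using definable_algebraI[of "Neg p" M n bs] p by (simp add: formulas_def)
qed

lemma Int_in_definable_algebra:
  assumes "A \<in> definable_algebra M" "B \<in> definable_algebra M"
  shows "A \<inter> B \<in> definable_algebra M"
proof -
  obtain n p bs where p: "p \<in> formulas (lang M) (Suc n)" "bs \<in> tuples M n"
    and A: "A = {a \<in> univ M. holds M p (a # bs)}"
    using assms unfolding definable_algebra_iff by blast
  obtain m q cs where q: "q \<in> formulas (lang M) (Suc m)" "cs \<in> tuples M m"
    and B: "B = {a \<in> univ M. holds M q (a # cs)}"
    using assms unfolding definable_algebra_iff by blast
  \<comment> \<open>\<open>r\<close> fixes the tested variable 0 and shifts the parameter variables
    of \<open>q\<close> past the \<open>n\<close> parameters of \<open>p\<close>, so that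
    \<open>bs @ cs\<close> serves both formulas.\<close>
  define r where "r i = (if i = 0 then 0 else i + n)" for i :: nat
  have r: "inj r" by (auto simp: r_def inj_on_def split: if_splits)
  have fv: "i < Suc n" if "i \<in> free_vars p" for i using p(1) that by (auto simp: formulas_def)
  have fvq: "i < Suc m" if "i \<in> free_vars q" for i using q(1) that by (auto simp: formulas_def)
  have len: "length bs = n" "length cs = m" using p q by (auto simp: tuples_def)
  have 1: "holds M p (a # bs @ cs) = holds M p (a # bs)" for a
    unfolding holds_def
  proof (rule sat_cong)
    fix i assume "i \<in> free_vars p"
    then have "i < Suc n" by (rule fv)
    then show "(a # bs @ cs) ! i = (a # bs) ! i" using len by (cases i) (simp_all add: nth_append)
  qed
  have 2: "holds M (rename_fm r q) (a # bs @ cs) = holds M q (a # cs)" for a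
    unfolding holds_def sat_rename_fm[OF r]
  proof (rule sat_cong)
    fix i
    show "(a # bs @ cs) ! r i = (a # cs) ! i"
      using len by (cases i) (simp_all add: r_def nth_append)
  qed
  have "A \<inter> B = {a \<in> univ M. holds M (Conj p (rename_fm r q)) (a # bs @ cs)}"
    unfolding A B 1[symmetric] 2[symmetric] by (auto simp: holds_def)
  moreover have "Conj p (rename_fm r q) \<in> formulas (lang M) (Suc (n + m))"
  proof -
    have "r i < Suc (n + m)" if "i \<in> free_vars q" for i
      using fvq[OF that] by (auto simp: r_def)
    moreover have "i < Suc (n + m)" if "i \<in> free_vars p" for i
      using fv[OF that] by simp
    ultimately show ?thesis
      using p(1) q(1) by (auto simp: formulas_def free_vars_rename_fm[OF r])
  qed
  moreover have "bs @ cs \<in> tuples M (n + m)" using p q by (auto simp: tuples_def)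
  ultimately show ?thesis using definable_algebraI by metis
qed

text \<open>The closure properties above make the trace an ultrafilter. Since parameters make
  singletons definable, the trace contains the complement of every point, so a nonempty definable
  set cannot generate it.\<close>

lemma nonprincipal_ultrafilter_on_definable_algebra:
  assumes "nonprincipal_ultrafilter_on (univ M) (Pow (univ M)) U"
  shows "nonprincipal_ultrafilter_on (univ M) (definable_algebra M) (U \<inter> definable_algebra M)"
proof -
  let ?B = "definable_algebra M"
  have U: "ultrafilter_on (univ M) (Pow (univ M)) U"
    using assms unfolding nonprincipal_ultrafilter_on_def by blast
  have B: "X \<subseteq> univ M" if "X \<in> ?B" for X using that by (simp add: definable_algebra_def)
  have ultra: "ultrafilter_on (univ M) ?B (U \<inter> ?B)"
  proof (rule ultrafilter_onI)
    show "univ M \<in> U \<inter> ?B" using ultrafilter_onD(2)[OF U] univ_in_definable_algebra by simp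
    show "{} \<notin> U \<inter> ?B" using ultrafilter_onD(3)[OF U] by simp
    show "X \<inter> Y \<in> U \<inter> ?B" if "X \<in> U \<inter> ?B" "Y \<in> U \<inter> ?B" for X Y
      using that ultrafilter_onD(4)[OF U, of X Y] Int_in_definable_algebra[of X M Y] by simp
    show "Y \<in> U \<inter> ?B" if "X \<in> U \<inter> ?B" "Y \<in> ?B" "X \<subseteq> Y" for X Y
      using that ultrafilter_onD(5)[OF U, of X Y] B[of Y] by simp
    show "X \<in> U \<inter> ?B \<or> univ M - X \<in> U \<inter> ?B" if "X \<in> ?B" for X
      using that ultrafilter_onD(6)[OF U, of X] B[of X] Diff_in_definable_algebra[of X M] by auto
  qed simp
  have "U \<inter> ?B \<noteq> {X \<in> ?B. A \<subseteq> X}" if A: "A \<in> ?B" for A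
  proof
    assume eq: "U \<inter> ?B = {X \<in> ?B. A \<subseteq> X}"
    with A have "A \<in> U" by blast
    then have "A \<noteq> {}" using ultrafilter_onD(3)[OF U] by auto
    then obtain a where a: "a \<in> A" by blast
    have a_univ: "a \<in> univ M" using a B[OF A] by blast
    have "univ M - {a} \<in> U \<inter> ?B"
      using ultrafilter_onD(6)[OF ultra singleton_in_definable_algebra[OF a_univ]]
        singleton_notin_nonprincipal_ultrafilter[OF assms] by simp
    then have "A \<subseteq> univ M - {a}" unfolding eq by simp
    then show False using a by blast
  qed
  with ultra show ?thesis unfolding nonprincipal_ultrafilter_on_def by simp
qed

section \<open>Criteria for Skolem functions and amenable ultrafilters\<close>

lemma map_nth_Var_args:
  "length ys = k \<Longrightarrow> map (tm_val M (\<lambda>i. (z # ys) ! i)) (map Var [1..<Suc k]) = ys"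
  "length ys = k \<Longrightarrow> map (tm_val M (\<lambda>i. ys ! i)) (map Var [0..<k]) = ys"
proof -
  assume len: "length ys = k"
  show "map (tm_val M (\<lambda>i. (z # ys) ! i)) (map Var [1..<Suc k]) = ys"
    by (rule nth_equalityI) (simp_all add: len del: upt_Suc)
next
  assume len: "length ys = k"
  show "map (tm_val M (\<lambda>i. ys ! i)) (map Var [0..<k]) = ys"
    by (rule nth_equalityI) (simp_all add: len)
qed

text \<open>The interpretation of a function symbol is definable without parameters, so it suffices
  that each formula has a symbol whose interpretation chooses witnesses.\<close>

lemma has_definable_Skolem_functionsI:
  assumes "is_structure M"
    and "\<And>k p. p \<in> formulas (lang M) (Suc k) \<Longrightarrow> \<exists>s. lang M s = Some (FunSym k) \<and>
      (\<forall>ys\<in>tuples M k. (\<exists>x\<in>univ M. holds M p (x # ys)) \<longrightarrow> holds M p (fun_interp M s ys # ys))"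
  shows "has_definable_Skolem_functions M"
  unfolding has_definable_Skolem_functions_def
proof (intro allI ballI)
  fix k p assume "p \<in> formulas (lang M) (Suc k)"
  from assms(2)[OF this] obtain s where s: "lang M s = Some (FunSym k)"
    and sk: "\<forall>ys\<in>tuples M k. (\<exists>x\<in>univ M. holds M p (x # ys)) \<longrightarrow> holds M p (fun_interp M s ys # ys)"
    by blast
  \<comment> \<open>The formula defining the graph: variable 0 holds the value, so the arguments
    start at variable 1.\<close>
  let ?q = "Equal (Var 0) (App s (map Var [1..<Suc k]))"
  have "definable_function M k (fun_interp M s)"
    unfolding definable_function_def
  proof (intro conjI bexI[of _ ?q] ballI)
    show "fun_interp M s ys \<in> univ M" if "ys \<in> tuples M k" for ys
      using assms(1) s that unfolding is_structure_def by blast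
    show "fun_interp M s ys = z \<longleftrightarrow> holds M ?q (z # ys)" if "ys \<in> tuples M k" for ys z
    proof -
      have "length ys = k" using that by (simp add: tuples_def)
      then show ?thesis
        unfolding holds_def sat.simps tm_val.simps map_nth_Var_args(1)[OF \<open>length ys = k\<close>]
        by auto
    qed
    show "?q \<in> formulas (lang M) (Suc k)" using s by (auto simp: formulas_def)
  qed
  with sk show "\<exists>f. definable_function M k f \<and>
      (\<forall>ys\<in>tuples M k. (\<exists>x\<in>univ M. holds M p (x # ys)) \<longrightarrow> holds M p (f ys # ys))"
    by blast
qed

text \<open>An atomic formula in the given relation symbol serves as $U_\<phi>$. The sets tested are
  definable, so belonging to the trace is the same as belonging to \<open>U\<close>.\<close>

lemma amenable_ultrafilterI:
  assumes "nonprincipal_ultrafilter_on (univ M) (Pow (univ M)) U"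
    and "\<And>k p. p \<in> formulas (lang M) (Suc k) \<Longrightarrow> \<exists>s. lang M s = Some (RelSym k) \<and>
      (\<forall>ys\<in>tuples M k. rel_interp M s ys \<longleftrightarrow> {a \<in> univ M. holds M p (a # ys)} \<in> U)"
  shows "amenable_ultrafilter M (U \<inter> definable_algebra M)"
  unfolding amenable_ultrafilter_def
proof (intro conjI allI ballI)
  show "nonprincipal_ultrafilter_on (univ M) (definable_algebra M) (U \<inter> definable_algebra M)"
    by (rule nonprincipal_ultrafilter_on_definable_algebra[OF assms(1)])
  fix k p assume p: "p \<in> formulas (lang M) (Suc k)"
  from assms(2)[OF this] obtain s where s: "lang M s = Some (RelSym k)"
    and rel: "\<And>ys. ys \<in> tuples M k \<Longrightarrow> rel_interp M s ys \<longleftrightarrow> {a \<in> univ M. holds M p (a # ys)} \<in> U"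
    by blast
  let ?q = "Atom s (map Var [0..<k])"
  show "\<exists>q\<in>formulas (lang M) k. \<forall>ms\<in>tuples M k.
      ({a \<in> univ M. holds M p (a # ms)} \<in> U \<inter> definable_algebra M) = holds M q ms"
  proof (intro bexI[of _ ?q] ballI)
    show "?q \<in> formulas (lang M) k" using s by (auto simp: formulas_def)
    fix ms assume ms: "ms \<in> tuples M k"
    then have "length ms = k" by (simp add: tuples_def)
    then have "holds M ?q ms = rel_interp M s ms"
      unfolding holds_def sat.simps by (simp only: map_nth_Var_args(2))
    then show "({a \<in> univ M. holds M p (a # ms)} \<in> U \<inter> definable_algebra M) = holds M ?q ms"
      using rel[OF ms] definable_algebraI[OF p ms] by simp
  qed
qed

subsection \<open>Symbols generated by formulas\<close>

text \<open>The recursion through \<open>fm\<close> collects in one type the symbols of all stages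
  of the usual iterated construction. The arity \<open>k\<close> is recorded because
  \<open>p\<close> does not determine it.\<close>

datatype 's skolem_symbol =
    Old 's
  | Skolem nat "'s skolem_symbol fm"
  | Large nat "'s skolem_symbol fm"

text \<open>When there is no witness the value is still an element of \<open>S\<close>, provided
  \<open>S\<close> is nonempty; this keeps the Skolem symbols interpreted by total operations on the
  universe.\<close>

definition pick :: "'m set \<Rightarrow> ('m \<Rightarrow> bool) \<Rightarrow> 'm" where
  "pick S P = (if \<exists>x\<in>S. P x then SOME x. x \<in> S \<and> P x else SOME x. x \<in> S)"

text \<open>
  The symbols of this structure interpret themselves, which makes the definition of \<open>interp\<close>
  below primitively recursive: the symbols in \<open>p\<close> are replaced by their interpretations.
\<close>

definition self_structure ::
    "'m set \<Rightarrow> (('m list \<Rightarrow> 'm) \<times> ('m list \<Rightarrow> bool), 'm) fo_structure" where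
  "self_structure S = \<lparr>univ = S, lang = Map.empty, fun_interp = fst, rel_interp = snd\<rparr>"

text \<open>Each symbol receives an operation and a relation, so that a single replacement map
  handles terms and atoms alike. For the new symbols the component of the other kind is an arbitrary
  default.\<close>

primrec interp :: "('s, 'm) fo_structure \<Rightarrow> 'm set set \<Rightarrow> 's skolem_symbol \<Rightarrow>
    ('m list \<Rightarrow> 'm) \<times> ('m list \<Rightarrow> bool)" where
  "interp M U (Old s) = (fun_interp M s, rel_interp M s)"
| "interp M U (Skolem k p) =
     (\<lambda>ys. pick (univ M)
        (\<lambda>x. holds (self_structure (univ M)) (map_fm (interp M U) p) (x # ys)), undefined)"
| "interp M U (Large k p) =
     (undefined,
      \<lambda>ys. {a \<in> univ M. holds (self_structure (univ M)) (map_fm (interp M U) p) (a # ys)} \<in> U)"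

subsection \<open>Counting the symbols\<close>

text \<open>The symbols have already been replaced by their code words \<open>w\<close>. A tag
  announces the constructor, and the number of arguments is written down so that a reader knows how
  many terms follow.\<close>

fun enc_tm :: "('b + nat) list tm \<Rightarrow> ('b + nat) list" where
  "enc_tm (Var i) = [Inr 0, Inr i]"
| "enc_tm (App w ts) = [Inr 1, Inr (length ts)] @ w @ concat (map enc_tm ts)"

fun enc_fm :: "('b + nat) list fm \<Rightarrow> ('b + nat) list" where
  "enc_fm (Equal t u) = Inr 0 # enc_tm t @ enc_tm u"
| "enc_fm (Atom w ts) = [Inr 1, Inr (length ts)] @ w @ concat (map enc_tm ts)"
| "enc_fm (Neg p) = Inr 2 # enc_fm p"
| "enc_fm (Conj p q) = Inr 3 # enc_fm p @ enc_fm q"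
| "enc_fm (Exists i p) = [Inr 4, Inr i] @ enc_fm p"

primrec enc_symbol :: "'s skolem_symbol \<Rightarrow> ('s + nat) list" where
  "enc_symbol (Old s) = [Inr 0, Inl s]"
| "enc_symbol (Skolem k p) = [Inr 1, Inr k] @ enc_fm (map_fm enc_symbol p)"
| "enc_symbol (Large k p) = [Inr 2, Inr k] @ enc_fm (map_fm enc_symbol p)"

text \<open>Unique readability in front of arbitrary remainders. Only \<open>a\<close> is confined
  to \<open>A\<close>: in the inductions below the hypothesis covers the constituents of the
  left-hand object, while the right-hand one is arbitrary.\<close>

definition prefix_free_on :: "('a \<Rightarrow> 'b list) \<Rightarrow> 'a set \<Rightarrow> bool" where
  "prefix_free_on f A \<longleftrightarrow> (\<forall>a\<in>A. \<forall>b xs ys. f a @ xs = f b @ ys \<longrightarrow> a = b \<and> xs = ys)"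

lemma prefix_free_onD:
  "prefix_free_on f A \<Longrightarrow> a \<in> A \<Longrightarrow> f a @ xs = f b @ ys \<Longrightarrow> a = b \<and> xs = ys"
  unfolding prefix_free_on_def by blast

lemma prefix_free_on_subset: "prefix_free_on f A \<Longrightarrow> B \<subseteq> A \<Longrightarrow> prefix_free_on f B"
  unfolding prefix_free_on_def by blast

text \<open>Code words are split off one at a time from the front. Equal lengths ensure that both
  lists end together and that what is left over is exactly the remainders.\<close>

lemma prefix_free_on_concat_map:
  assumes "length ts = length us" and "prefix_free_on f (set ts)"
    and "concat (map f ts) @ xs = concat (map f us) @ ys"
  shows "ts = us \<and> xs = ys"
  using assms
proof (induction ts us rule: list_induct2)
  case (Cons t ts u us)
  have "f t @ concat (map f ts) @ xs = f u @ concat (map f us) @ ys"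
    using Cons.prems(2) by simp
  then have 1: "t = u \<and> concat (map f ts) @ xs = concat (map f us) @ ys"
    by (rule prefix_free_onD[OF Cons.prems(1), rotated]) simp
  have "prefix_free_on f (set ts)"
    by (rule prefix_free_on_subset[OF Cons.prems(1)]) auto
  with 1 show ?case using Cons.IH by simp
qed simp

text \<open>The tag determines the constructor of \<open>u\<close> and the stored length the number
  of arguments; then the symbol and the arguments are read off in turn. The map \<open>c\<close> is
  controlled only on the symbols of \<open>t\<close>, which is all that the later induction on
  symbols provides.\<close>

lemma prefix_free_enc_tm:
  assumes "prefix_free_on c (set_tm t)"
    and "enc_tm (map_tm c t) @ xs = enc_tm (map_tm c u) @ ys"
  shows "t = u \<and> xs = ys"
  using assms
proof (induction t arbitrary: u xs ys)
  case (Var i)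
  then show ?case by (cases u) auto
next
  case (App s ts)
  from App.prems(2) obtain s' us where u: "u = App s' us" by (cases u) auto
  have len: "length ts = length us"
    and eq: "c s @ concat (map (enc_tm \<circ> map_tm c) ts) @ xs =
             c s' @ concat (map (enc_tm \<circ> map_tm c) us) @ ys"
    using App.prems(2) by (simp_all add: u)
  have s: "s = s' \<and> concat (map (enc_tm \<circ> map_tm c) ts) @ xs =
                concat (map (enc_tm \<circ> map_tm c) us) @ ys"
    by (rule prefix_free_onD[OF App.prems(1) _ eq]) simp
  have "prefix_free_on c (set_tm t)" if "t \<in> set ts" for t
    by (rule prefix_free_on_subset[OF App.prems(1)]) (use that in auto)
  then have "prefix_free_on (enc_tm \<circ> map_tm c) (set ts)"
    unfolding prefix_free_on_def[of "enc_tm \<circ> map_tm c"] o_apply using App.IH by blast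
  then have "ts = us \<and> xs = ys"
    by (rule prefix_free_on_concat_map[OF len _ conjunct2[OF s]])
  then show ?case using s u by simp
qed

lemma prefix_free_enc_fm:
  assumes "prefix_free_on c (set_fm p)"
    and "enc_fm (map_fm c p) @ xs = enc_fm (map_fm c q) @ ys"
  shows "p = q \<and> xs = ys"
  using assms
proof (induction p arbitrary: q xs ys)
  case (Equal t u)
  from Equal.prems(2) obtain t' u' where q: "q = Equal t' u'" by (cases q) auto
  have c: "prefix_free_on c (set_tm t)" "prefix_free_on c (set_tm u)"
    by (rule prefix_free_on_subset[OF Equal.prems(1)], simp)+
  have eq: "enc_tm (map_tm c t) @ enc_tm (map_tm c u) @ xs =
            enc_tm (map_tm c t') @ enc_tm (map_tm c u') @ ys"
    using Equal.prems(2) by (simp add: q)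
  from prefix_free_enc_tm[OF c(1) eq]
  have t: "t = t' \<and> enc_tm (map_tm c u) @ xs = enc_tm (map_tm c u') @ ys" .
  from prefix_free_enc_tm[OF c(2) conjunct2[OF t]] t q show ?case by simp
next
  case (Atom s ts)
  from Atom.prems(2) obtain s' us where q: "q = Atom s' us" by (cases q) auto
  have len: "length ts = length us"
    and eq: "c s @ concat (map (enc_tm \<circ> map_tm c) ts) @ xs =
             c s' @ concat (map (enc_tm \<circ> map_tm c) us) @ ys"
    using Atom.prems(2) by (simp_all add: q)
  have s: "s = s' \<and> concat (map (enc_tm \<circ> map_tm c) ts) @ xs =
                concat (map (enc_tm \<circ> map_tm c) us) @ ys"
    by (rule prefix_free_onD[OF Atom.prems(1) _ eq]) simp
  have "prefix_free_on c (set_tm t)" if "t \<in> set ts" for t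
    by (rule prefix_free_on_subset[OF Atom.prems(1)]) (use that in auto)
  then have "prefix_free_on (enc_tm \<circ> map_tm c) (set ts)"
    unfolding prefix_free_on_def[of "enc_tm \<circ> map_tm c"] o_apply
    using prefix_free_enc_tm by blast
  then have "ts = us \<and> xs = ys"
    by (rule prefix_free_on_concat_map[OF len _ conjunct2[OF s]])
  then show ?case using s q by simp
next
  case (Neg p)
  from Neg.prems(2) obtain p' where q: "q = Neg p'" by (cases q) auto
  have "p = p' \<and> xs = ys"
    by (rule Neg.IH) (use Neg.prems q in simp_all)
  then show ?case using q by simp
next
  case (Conj p1 p2)
  from Conj.prems(2) obtain q1 q2 where q: "q = Conj q1 q2" by (cases q) auto
  have c: "prefix_free_on c (set_fm p1)" "prefix_free_on c (set_fm p2)"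
    by (rule prefix_free_on_subset[OF Conj.prems(1)], simp)+
  have 1: "p1 = q1 \<and> enc_fm (map_fm c p2) @ xs = enc_fm (map_fm c q2) @ ys"
    by (rule Conj.IH(1)[OF c(1)]) (use Conj.prems q in simp)
  from Conj.IH(2)[OF c(2) conjunct2[OF 1]] 1 q show ?case by simp
next
  case (Exists i p)
  from Exists.prems(2) obtain j p' where q: "q = Exists j p'" by (cases q) auto
  have "p = p' \<and> xs = ys"
    by (rule Exists.IH) (use Exists.prems q in simp_all)
  then show ?case using Exists.prems(2) q by simp
qed

text \<open>The induction hypothesis says that \<open>enc_symbol\<close> is prefix free on the
  symbols occurring in \<open>p\<close>, which is what reading the code of the formula
  \<open>p\<close> requires.\<close>

lemma prefix_free_enc_symbol:
  "enc_symbol s @ xs = enc_symbol s' @ ys \<Longrightarrow> s = s' \<and> xs = ys"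
proof (induction s arbitrary: s' xs ys)
  case (Old s)
  then show ?case by (cases s') auto
next
  case (Skolem k p)
  from Skolem.prems obtain q where q: "s' = Skolem k q" by (cases s') auto
  have "prefix_free_on enc_symbol (set_fm p)"
    unfolding prefix_free_on_def using Skolem.IH by blast
  then have "p = q \<and> xs = ys"
    by (rule prefix_free_enc_fm) (use Skolem.prems q in simp)
  then show ?case using q by simp
next
  case (Large k p)
  from Large.prems obtain q where q: "s' = Large k q" by (cases s') auto
  have "prefix_free_on enc_symbol (set_fm p)"
    unfolding prefix_free_on_def using Large.IH by blast
  then have "p = q \<and> xs = ys"
    by (rule prefix_free_enc_fm) (use Large.prems q in simp)
  then show ?case using q by simp
qed

lemma inj_enc_symbol: "inj enc_symbol"
  using prefix_free_enc_symbol[of _ "[]" _ "[]"] by (auto intro: injI)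

lemma set_enc_tm: "set (enc_tm t) \<subseteq> range Inr \<union> \<Union> (set ` set_tm t)"
proof (induction t)
  case (App w ts)
  have "set (enc_tm t) \<subseteq> range Inr \<union> \<Union> (set ` set_tm (App w ts))" if "t \<in> set ts" for t
    by (rule subset_trans[OF App.IH[OF that]]) (use that in auto)
  then have "(\<Union>t\<in>set ts. set (enc_tm t)) \<subseteq> range Inr \<union> \<Union> (set ` set_tm (App w ts))"
    by blast
  then show ?case by (simp, blast)
qed simp

lemma set_enc_fm: "set (enc_fm p) \<subseteq> range Inr \<union> \<Union> (set ` set_fm p)"
proof (induction p)
  case (Equal t u)
  then show ?case using set_enc_tm[of t] set_enc_tm[of u] by auto
next
  case (Atom w ts)
  have "set (enc_tm t) \<subseteq> range Inr \<union> \<Union> (set ` set_fm (Atom w ts))" if "t \<in> set ts" for t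
    by (rule subset_trans[OF set_enc_tm]) (use that in auto)
  then have "(\<Union>t\<in>set ts. set (enc_tm t)) \<subseteq> range Inr \<union> \<Union> (set ` set_fm (Atom w ts))"
    by blast
  then show ?case by (simp, blast)
qed auto

text \<open>This confines the codes of symbols generated over \<open>D\<close> to words over
  \<open>D\<close> and the naturals, so the count depends on \<open>D\<close> and not on the whole
  type \<open>'s\<close>.\<close>

lemma set_enc_symbol: "set (enc_symbol s) \<subseteq> set_skolem_symbol s <+> UNIV"
proof (induction s)
  case (Skolem k p)
  have "set (enc_symbol s) \<subseteq> set_skolem_symbol (Skolem k p) <+> UNIV" if "s \<in> set_fm p" for s
    by (rule subset_trans[OF Skolem.IH[OF that]]) (use that in auto)
  then have "\<Union> (set ` set_fm (map_fm enc_symbol p)) \<subseteq> set_skolem_symbol (Skolem k p) <+> UNIV"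
    unfolding fm.set_map by blast
  then have "set (enc_fm (map_fm enc_symbol p)) \<subseteq> set_skolem_symbol (Skolem k p) <+> UNIV"
    using set_enc_fm[of "map_fm enc_symbol p"] by blast
  then show ?case by (simp add: InrI)
next
  case (Large k p)
  have "set (enc_symbol s) \<subseteq> set_skolem_symbol (Large k p) <+> UNIV" if "s \<in> set_fm p" for s
    by (rule subset_trans[OF Large.IH[OF that]]) (use that in auto)
  then have "\<Union> (set ` set_fm (map_fm enc_symbol p)) \<subseteq> set_skolem_symbol (Large k p) <+> UNIV"
    unfolding fm.set_map by blast
  then have "set (enc_fm (map_fm enc_symbol p)) \<subseteq> set_skolem_symbol (Large k p) <+> UNIV"
    using set_enc_fm[of "map_fm enc_symbol p"] by blast
  then show ?case by (simp add: InrI)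
qed auto

section \<open>Cardinal arithmetic for the set of generated symbols\<close>

lemma lepoll_iff_card_of_ordLeq: "A \<lesssim> B \<longleftrightarrow> ordLeq3 (card_of A) (card_of B)"
  by (simp add: lepoll_def card_of_ordLeq)

lemma Plus_lepoll_infinite:
  assumes "infinite C" "A \<lesssim> C" "B \<lesssim> C"
  shows "A <+> B \<lesssim> C"
proof -
  have "A <+> B \<lesssim> C <+> C" by (rule sum_lepoll_mono[OF assms(2,3)])
  moreover have "C <+> C \<approx> C"
    using assms(1) by (simp add: eqpoll_iff_card_of_ordIso card_of_Plus_infinite1 card_of_refl ordIso_imp_ordLeq)
  ultimately show ?thesis using lepoll_trans2 by blast
qed

text \<open>Since \<open>A \<times> A \<approx> A\<close> for infinite \<open>A\<close>, induction
  bounds the words of each fixed length by \<open>A\<close>; all words form a countable union of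
  such sets.\<close>

lemma lists_lepoll_infinite:
  assumes "infinite A"
  shows "lists A \<lesssim> A"
proof -
  have n: "{xs \<in> lists A. length xs = n} \<lesssim> A" for n
  proof (induction n)
    case 0
    have "{xs \<in> lists A. length xs = 0} \<lesssim> {[] :: 'a list}" by (rule subset_imp_lepoll) auto
    also have "{[] :: 'a list} \<lesssim> A" using assms by (simp add: finite_lepoll_infinite)
    finally show ?case .
  next
    case (Suc n)
    have "{xs \<in> lists A. length xs = Suc n} \<lesssim> A \<times> {xs \<in> lists A. length xs = n}"
      unfolding lepoll_def
    proof (intro exI conjI)
      show "inj_on (\<lambda>xs. (hd xs, tl xs)) {xs \<in> lists A. length xs = Suc n}"
        by (intro inj_onI list.expand) auto
      show "(\<lambda>xs. (hd xs, tl xs)) ` {xs \<in> lists A. length xs = Suc n} \<subseteq>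
          A \<times> {xs \<in> lists A. length xs = n}"
        by (auto simp: length_Suc_conv)
    qed
    also have "\<dots> \<lesssim> A \<times> A" by (rule times_lepoll_mono[OF lepoll_refl Suc])
    also have "\<dots> \<approx> A"
      using assms by (simp add: eqpoll_iff_card_of_ordIso card_of_Times_same_infinite)
    finally show ?case .
  qed
  have "lists A = (\<Union>n. {xs \<in> lists A. length xs = n})" by auto
  also have "\<dots> \<lesssim> A"
    unfolding lepoll_iff_card_of_ordLeq
  proof (rule card_of_UNION_ordLeq_infinite[OF assms])
    show "ordLeq3 (card_of (UNIV :: nat set)) (card_of A)"
      using assms by (simp only: infinite_le_lepoll lepoll_iff_card_of_ordLeq)
    show "\<forall>n\<in>UNIV. ordLeq3 (card_of {xs \<in> lists A. length xs = n}) (card_of A)"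
      using n by (simp only: lepoll_iff_card_of_ordLeq simp_thms ball_UNIV)
  qed
  finally show ?thesis .
qed

lemma symbols_lepoll: "{x. set_skolem_symbol x \<subseteq> D} \<lesssim> D <+> (UNIV :: nat set)"
proof -
  have "{x. set_skolem_symbol x \<subseteq> D} \<lesssim> lists (D <+> (UNIV :: nat set))"
    unfolding lepoll_def
  proof (intro exI conjI)
    show "inj_on enc_symbol {x. set_skolem_symbol x \<subseteq> D}"
      using inj_enc_symbol by (rule inj_on_subset) simp
    show "enc_symbol ` {x. set_skolem_symbol x \<subseteq> D} \<subseteq> lists (D <+> UNIV)"
      using set_enc_symbol by fastforce
  qed
  also have "\<dots> \<lesssim> D <+> (UNIV :: nat set)"
    by (rule lists_lepoll_infinite) simp
  finally show ?thesis .
qed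

lemma Plus_nat_lepoll_lists: "(D :: 's set) <+> (UNIV :: nat set) \<lesssim> (UNIV :: 's list set)"
  unfolding lepoll_def
proof (intro exI conjI)
  \<comment> \<open>Elements of \<open>D\<close> become words of length 1 and a number
    \<open>n\<close> a word of length \<open>n + 2\<close> in one fixed letter, so lengths keep all
    these words apart.\<close>
  show "inj_on (case_sum (\<lambda>s. [s]) (\<lambda>n. replicate (n + 2) undefined)) (D <+> (UNIV :: nat set))"
    by (auto simp: inj_on_def)
qed simp

text \<open>The upper bound is \<open>D <+> UNIV\<close>, which the larger of the two summands
  absorbs; the lower bounds embed the naturals and \<open>D\<close> separately.\<close>

lemma symbols_eqpoll_max:
  fixes D :: "'s set"
  shows "D \<lesssim> (UNIV :: nat set) \<Longrightarrow> {x. set_skolem_symbol x \<subseteq> D} \<approx> (UNIV :: nat set)"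
    and "(UNIV :: nat set) \<lesssim> D \<Longrightarrow> {x. set_skolem_symbol x \<subseteq> D} \<approx> D"
proof -
  \<comment> \<open>The formula \<open>Equal (Var 0) (Var 0)\<close> contains no symbols, so its
    Skolem symbols, one for each arity \<open>k\<close>, are present whatever \<open>D\<close>
    is.\<close>
  have nat: "(UNIV :: nat set) \<lesssim> {x. set_skolem_symbol x \<subseteq> D}"
    unfolding lepoll_def
    by (rule exI[of _ "\<lambda>k. Skolem k (Equal (Var 0) (Var 0))"]) (auto simp: inj_on_def)
  have D: "D \<lesssim> {x. set_skolem_symbol x \<subseteq> D}"
    unfolding lepoll_def by (rule exI[of _ Old]) (auto simp: inj_on_def)
  show "{x. set_skolem_symbol x \<subseteq> D} \<approx> (UNIV :: nat set)" if "D \<lesssim> (UNIV :: nat set)"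
    by (rule lepoll_antisym[OF lepoll_trans[OF symbols_lepoll] nat])
       (rule Plus_lepoll_infinite[OF _ that], simp_all)
  show "{x. set_skolem_symbol x \<subseteq> D} \<approx> D" if "(UNIV :: nat set) \<lesssim> D"
    by (rule lepoll_antisym[OF lepoll_trans[OF symbols_lepoll] D])
       (rule Plus_lepoll_infinite[OF _ _ that], use that in \<open>simp_all add: infinite_le_lepoll\<close>)
qed

subsection \<open>The expansion\<close>

lemma pick_in: "S \<noteq> {} \<Longrightarrow> pick S P \<in> S"
  unfolding pick_def by (metis (mono_tags, lifting) all_not_in_conv someI_ex)

lemma pick_satisfies: "\<exists>x\<in>S. P x \<Longrightarrow> P (pick S P)"
  unfolding pick_def by (metis (mono_tags, lifting) someI_ex)

lemma tm_in_imp_set_tm: "tm_in L t \<Longrightarrow> set_tm t \<subseteq> dom L"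
proof (induction t)
  case (App s ts)
  have "set_tm t \<subseteq> dom L" if "t \<in> set ts" for t
    using App.IH[OF that] App.prems that by simp
  moreover have "s \<in> dom L" using App.prems by (simp add: domI)
  ultimately show ?case by auto
qed simp

lemma fm_in_imp_set_fm: "fm_in L p \<Longrightarrow> set_fm p \<subseteq> dom L"
proof (induction p)
  case (Equal t u)
  then show ?case using tm_in_imp_set_tm[of L t] tm_in_imp_set_tm[of L u] by simp
next
  case (Atom s ts)
  have "set_tm t \<subseteq> dom L" if "t \<in> set ts" for t
    using tm_in_imp_set_tm[of L t] Atom.prems that by simp
  moreover have "s \<in> dom L" using Atom.prems by (simp add: domI)
  ultimately show ?case by auto
qed simp_all

text \<open>
  The formula \<open>p\<close> in \<open>Skolem k p\<close> and \<open>Large k p\<close> need not respect arities; only its symbols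
  are restricted. The superfluous symbols affect neither the structure nor the cardinality.
\<close>

definition symbol_lang :: "'s language \<Rightarrow> 's skolem_symbol language" where
  "symbol_lang L x =
     (if set_skolem_symbol x \<subseteq> dom L
      then case x of Old s \<Rightarrow> L s | Skolem k p \<Rightarrow> Some (FunSym k) | Large k p \<Rightarrow> Some (RelSym k)
      else None)"

lemma dom_symbol_lang: "dom (symbol_lang L) = {x. set_skolem_symbol x \<subseteq> dom L}"
proof (rule set_eqI)
  fix x
  show "x \<in> dom (symbol_lang L) \<longleftrightarrow> x \<in> {x. set_skolem_symbol x \<subseteq> dom L}"
    by (cases x) (simp_all add: symbol_lang_def domIff)
qed

text \<open>The map \<open>c\<close> places the generated symbols in the target type
  \<open>'t\<close>. It is inverted only on the symbols over the language of \<open>M\<close>, where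
  it is injective.\<close>

locale symbol_coding =
  fixes M :: "('s, 'm) fo_structure" and U :: "'m set set" and c :: "'s skolem_symbol \<Rightarrow> 't"
  assumes struct: "is_structure M"
    and inj_symbols: "inj_on c {x. set_skolem_symbol x \<subseteq> dom (lang M)}"
begin

definition symbols :: "'s skolem_symbol set" where
  "symbols = {x. set_skolem_symbol x \<subseteq> dom (lang M)}"

definition expansion :: "('t, 'm) fo_structure" where
  "expansion = \<lparr>univ = univ M,
     lang = (\<lambda>y. if y \<in> c ` symbols then symbol_lang (lang M) (inv_into symbols c y) else None),
     fun_interp = (\<lambda>y. fst (interp M U (inv_into symbols c y))),
     rel_interp = (\<lambda>y. snd (interp M U (inv_into symbols c y)))\<rparr>"

lemma inj: "inj_on c symbols"
  using inj_symbols by (simp add: symbols_def)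

lemma univ_expansion: "univ expansion = univ M"
  by (simp add: expansion_def)

lemma tuples_expansion: "tuples expansion n = tuples M n"
  by (simp add: tuples_def univ_expansion)

lemma lang_expansion: "x \<in> symbols \<Longrightarrow> lang expansion (c x) = symbol_lang (lang M) x"
  using inj by (simp add: expansion_def)

lemma fun_interp_expansion: "x \<in> symbols \<Longrightarrow> fun_interp expansion (c x) = fst (interp M U x)"
  using inj by (simp add: expansion_def)

lemma rel_interp_expansion: "x \<in> symbols \<Longrightarrow> rel_interp expansion (c x) = snd (interp M U x)"
  using inj by (simp add: expansion_def)

lemma dom_lang_expansion: "dom (lang expansion) = c ` symbols"
proof
  show "dom (lang expansion) \<subseteq> c ` symbols"
    by (auto simp: expansion_def split: if_splits)
  show "c ` symbols \<subseteq> dom (lang expansion)"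
  proof
    fix y assume "y \<in> c ` symbols"
    then obtain x where x: "x \<in> symbols" "y = c x" by blast
    then have "x \<in> dom (symbol_lang (lang M))" by (simp only: dom_symbol_lang symbols_def)
    then show "y \<in> dom (lang expansion)" using lang_expansion[OF x(1)] x(2) by (simp add: dom_def)
  qed
qed

lemma is_structure_expansion: "is_structure expansion"
  unfolding is_structure_def univ_expansion tuples_expansion
proof (intro conjI allI impI ballI)
  show ne: "univ M \<noteq> {}" using struct by (simp add: is_structure_def)
  fix y n xs assume y: "lang expansion y = Some (FunSym n)" and xs: "xs \<in> tuples M n"
  then have "y \<in> c ` symbols" using dom_lang_expansion by blast
  then obtain x where x: "x \<in> symbols" "y = c x" by blast
  have L: "symbol_lang (lang M) x = Some (FunSym n)" using y x lang_expansion by simp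
  show "fun_interp expansion y xs \<in> univ M"
  proof (cases x)
    case (Old s)
    then have "lang M s = Some (FunSym n)" using L by (simp add: symbol_lang_def split: if_splits)
    then have "fun_interp M s xs \<in> univ M" using struct xs unfolding is_structure_def by blast
    then show ?thesis using Old x by (simp add: fun_interp_expansion)
  next
    case (Skolem k p)
    then show ?thesis using x pick_in[OF ne] by (simp add: fun_interp_expansion)
  next
    case (Large k p)
    then show ?thesis using L by (simp add: symbol_lang_def split: if_splits)
  qed
qed

lemma expansion_via_expansion: "expansion_via (\<lambda>s. c (Old s)) M expansion"
proof -
  have Old: "Old s \<in> symbols" if "s \<in> dom (lang M)" for s
    using that unfolding symbols_def by simp
  have "inj_on (\<lambda>s. c (Old s)) (dom (lang M))"
    using inj Old by (auto simp: inj_on_def)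
  moreover have "lang expansion (c (Old s)) = lang M s" if "s \<in> dom (lang M)" for s
    using lang_expansion[OF Old[OF that]] that by (simp add: symbol_lang_def)
  moreover have "fun_interp expansion (c (Old s)) = fun_interp M s"
      "rel_interp expansion (c (Old s)) = rel_interp M s" if "s \<in> dom (lang M)" for s
    using fun_interp_expansion[OF Old[OF that]] rel_interp_expansion[OF Old[OF that]] by simp_all
  ultimately show ?thesis
    unfolding expansion_via_def by (simp add: is_structure_expansion univ_expansion domI)
qed

text \<open>This is the closure of the language: a formula over the finished expansion, with its
  symbols decoded, may itself label a \<open>Skolem\<close> or \<open>Large\<close> symbol of any
  arity \<open>k\<close>. No further stages are required.\<close>

lemma formula_as_symbol:
  assumes "p \<in> formulas (lang expansion) n"
  obtains q where "Skolem k q \<in> symbols" "Large k q \<in> symbols"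
    "\<And>xs. holds (self_structure (univ M)) (map_fm (interp M U) q) xs = holds expansion p xs"
proof
  let ?q = "map_fm (inv_into symbols c) p"
  have "set_fm p \<subseteq> c ` symbols"
    using assms fm_in_imp_set_fm[of "lang expansion" p] by (simp add: formulas_def dom_lang_expansion)
  then have "inv_into symbols c y \<in> symbols" if "y \<in> set_fm p" for y
    using inv_into_into[of y c symbols] subsetD[OF _ that] by simp
  then have "set_skolem_symbol x \<subseteq> dom (lang M)" if "x \<in> set_fm ?q" for x
    using that unfolding symbols_def fm.set_map by blast
  then show "Skolem k ?q \<in> symbols" "Large k ?q \<in> symbols"
    unfolding symbols_def by auto
  \<comment> \<open>The expansion interprets a symbol by decoding it and applying
    \<open>interp\<close>, so \<open>sat_map_fm\<close> applies with the composite of these two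
    maps.\<close>
  show "holds (self_structure (univ M)) (map_fm (interp M U) ?q) xs = holds expansion p xs" for xs
    unfolding holds_def fm.map_comp
    by (rule sat_map_fm[symmetric])
       (simp_all add: univ_expansion self_structure_def expansion_def)
qed

lemma has_definable_Skolem_functions_expansion: "has_definable_Skolem_functions expansion"
proof (rule has_definable_Skolem_functionsI[OF is_structure_expansion])
  fix k p assume "p \<in> formulas (lang expansion) (Suc k)"
  then obtain q where q: "Skolem k q \<in> symbols" "Large k q \<in> symbols"
      "\<And>xs. holds (self_structure (univ M)) (map_fm (interp M U) q) xs = holds expansion p xs"
    by (rule formula_as_symbol[where k = k]) (rule that)
  show "\<exists>s. lang expansion s = Some (FunSym k) \<and> (\<forall>ys\<in>tuples expansion k.
      (\<exists>x\<in>univ expansion. holds expansion p (x # ys)) \<longrightarrow> holds expansion p (fun_interp expansion s ys # ys))"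
  proof (intro exI conjI ballI impI)
    show "lang expansion (c (Skolem k q)) = Some (FunSym k)"
      using lang_expansion[OF q(1)] q(1) unfolding symbols_def
      by (simp add: symbol_lang_def)
    fix ys assume "\<exists>x\<in>univ expansion. holds expansion p (x # ys)"
    then have "holds expansion p (pick (univ M) (\<lambda>x. holds expansion p (x # ys)) # ys)"
      unfolding univ_expansion by (rule pick_satisfies)
    \<comment> \<open>By \<open>q(3)\<close> the choice made in \<open>interp\<close> for
      \<open>Skolem k q\<close> is a choice of witnesses for \<open>p\<close> itself.\<close>
    then show "holds expansion p (fun_interp expansion (c (Skolem k q)) ys # ys)"
      by (simp add: fun_interp_expansion[OF q(1)] q(3))
  qed
qed

lemma amenable_ultrafilter_expansion:
  assumes "nonprincipal_ultrafilter_on (univ M) (Pow (univ M)) U"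
  shows "amenable_ultrafilter expansion (U \<inter> definable_algebra expansion)"
proof (rule amenable_ultrafilterI)
  show "nonprincipal_ultrafilter_on (univ expansion) (Pow (univ expansion)) U"
    using assms by (simp add: univ_expansion)
  fix k p assume "p \<in> formulas (lang expansion) (Suc k)"
  then obtain q where q: "Skolem k q \<in> symbols" "Large k q \<in> symbols"
      "\<And>xs. holds (self_structure (univ M)) (map_fm (interp M U) q) xs = holds expansion p xs"
    by (rule formula_as_symbol[where k = k]) (rule that)
  show "\<exists>s. lang expansion s = Some (RelSym k) \<and> (\<forall>ys\<in>tuples expansion k.
      rel_interp expansion s ys = ({a \<in> univ expansion. holds expansion p (a # ys)} \<in> U))"
  proof (intro exI conjI ballI)
    show "lang expansion (c (Large k q)) = Some (RelSym k)"
      using lang_expansion[OF q(2)] q(2) unfolding symbols_def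
      by (simp add: symbol_lang_def)
    show "rel_interp expansion (c (Large k q)) ys = ({a \<in> univ expansion. holds expansion p (a # ys)} \<in> U)" for ys
      by (simp add: rel_interp_expansion[OF q(2)] q(3) univ_expansion)
  qed
qed

lemma card_is_max_aleph0_expansion: "card_is_max_aleph0 (lang expansion) (lang M)"
proof -
  have "dom (lang expansion) \<approx> {x. set_skolem_symbol x \<subseteq> dom (lang M)}"
    using inj_on_image_eqpoll_self[OF inj] by (simp add: dom_lang_expansion symbols_def)
  then show ?thesis
    unfolding card_is_max_aleph0_def
    by (intro conjI impI; elim eqpoll_trans[OF _ symbols_eqpoll_max(1)] eqpoll_trans[OF _ symbols_eqpoll_max(2)])
qed

end

section \<open>Coding into the prescribed symbol type and conclusion\<close>

lemma symbol_coding_exists: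
  fixes D :: "'s set"
  obtains c :: "'s skolem_symbol \<Rightarrow> 's exp_symbol"
  where "inj_on c {x. set_skolem_symbol x \<subseteq> D}" and "\<And>s. c (Old s) = Inl s"
proof -
  obtain g :: "'s skolem_symbol \<Rightarrow> 's list" where g: "inj_on g {x. set_skolem_symbol x \<subseteq> D}"
    using lepoll_trans[OF symbols_lepoll[of D] Plus_nat_lepoll_lists[of D]]
    unfolding lepoll_def by (elim exE conjE)
  \<comment> \<open>Old symbols must go to \<open>Inl\<close>, as an expansion via
    \<open>Inl\<close> demands. The new ones go to \<open>Inr\<close> through \<open>g\<close>,
    which exists because at most \<open>D <+> UNIV\<close> many symbols are generated and these
    embed in the words over \<open>'s\<close>.\<close>
  define c :: "'s skolem_symbol \<Rightarrow> 's exp_symbol"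
    where "c x = (case x of Old s \<Rightarrow> Inl s | _ \<Rightarrow> Inr (g x))" for x
  show thesis
  proof
    show "inj_on c {x. set_skolem_symbol x \<subseteq> D}"
    proof (rule inj_onI)
      fix x y assume xy: "x \<in> {x. set_skolem_symbol x \<subseteq> D}" "y \<in> {x. set_skolem_symbol x \<subseteq> D}"
        and eq: "c x = c y"
      show "x = y"
        using eq inj_onD[OF g _ xy] by (cases x; cases y) (simp_all add: c_def)
    qed
  qed (simp add: c_def)
qed

theorem theorem3p2:
  fixes M :: "('s, 'm) fo_structure"
  assumes "is_structure M" and "infinite (univ M)"
  shows "(\<exists>M' :: ('s exp_symbol, 'm) fo_structure.
            expansion_via Inl M M' \<and> amenable M' \<and> card_is_max_aleph0 (lang M') (lang M)) \<and>
         (\<forall>U. nonprincipal_ultrafilter_on (univ M) (Pow (univ M)) U \<longrightarrow>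
            (\<exists>M' :: ('s exp_symbol, 'm) fo_structure.
               expansion_via Inl M M' \<and> has_definable_Skolem_functions M' \<and>
               card_is_max_aleph0 (lang M') (lang M) \<and>
               (\<exists>U'\<subseteq>U. amenable_ultrafilter M' U')))"
proof -
  obtain c :: "'s skolem_symbol \<Rightarrow> 's exp_symbol"
    where inj: "inj_on c {x. set_skolem_symbol x \<subseteq> dom (lang M)}" and Old: "\<And>s. c (Old s) = Inl s"
    by (rule symbol_coding_exists[of "dom (lang M)"]) (rule that)
  \<comment> \<open>The claim for a prescribed \<open>U\<close> comes first; the set
    \<open>U'\<close> is the trace of \<open>U\<close> on the definable algebra of the
    expansion.\<close>
  have *: "\<exists>M' :: ('s exp_symbol, 'm) fo_structure.
      expansion_via Inl M M' \<and> has_definable_Skolem_functions M' \<and>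
      card_is_max_aleph0 (lang M') (lang M) \<and> (\<exists>U'\<subseteq>U. amenable_ultrafilter M' U')"
    if U: "nonprincipal_ultrafilter_on (univ M) (Pow (univ M)) U" for U
  proof -
    interpret symbol_coding M U c
      by unfold_locales (use assms(1) inj in auto)
    have "expansion_via Inl M expansion"
      using expansion_via_expansion by (simp add: Old)
    then show ?thesis
      using has_definable_Skolem_functions_expansion card_is_max_aleph0_expansion
        amenable_ultrafilter_expansion[OF U] Int_lower1 by (intro exI conjI)
  qed
  \<comment> \<open>The existence of an amenable expansion follows by applying this claim to any
    nonprincipal ultrafilter on the infinite universe.\<close>
  obtain U where "nonprincipal_ultrafilter_on (univ M) (Pow (univ M)) U"
    using nonprincipal_ultrafilter_exists[OF assms(2)] by blast
  from *[OF this] have "\<exists>M' :: ('s exp_symbol, 'm) fo_structure.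
      expansion_via Inl M M' \<and> amenable M' \<and> card_is_max_aleph0 (lang M') (lang M)"
    unfolding amenable_def by blast
  then show ?thesis using * by simp
qed

end
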